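(* For every integer $n\ge0$ we have $\mathrm{ac}_+(n)=T'_{n+1}$, and consequently $\mathrm{ac}(n)=T'_{n+1}+T'_n$.
   Context: A composition of $n$ is a finite sequence $\alpha=(\alpha_1,\ldots,\alpha_\ell)$ of positive integers with $\alpha_1+\cdots+\alpha_\ell=n$; the empty sequence ($\ell=0$) is the only composition of $0$. $\mathrm{ac}(n)$ is the number of anti-palindromic compositions of $n$, i.e. compositions $\alpha=(\alpha_1,\ldots,\alpha_\ell)$ of $n$ with $\alpha_i\ne\alpha_{\ell+1-i}$ for all $1\le i\le\ell/2$. $\mathrm{ac}_+(n)$ is the number of those anti-palindromic compositions of $n$ for which either $\ell$ is even, or $\ell$ is odd and the middle part $\alpha_{(\ell+1)/2}$ is even. $T'_n$ is defined by $T'_0=0$, $T'_1=1$, $T'_2=0$, and $T'_n=T'_{n-1}+T'_{n-2}+T'_{n-3}$ for $n\ge3$. *)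

theory Defs
  imports Main
begin

definition is_composition :: "nat \<Rightarrow> nat list \<Rightarrow> bool" where
  "is_composition n \<alpha> \<longleftrightarrow> (\<forall>a \<in> set \<alpha>. a > 0) \<and> sum_list \<alpha> = n"

text \<open>Parts are numbered from 1, list positions from 0; \<open>part \<alpha> i\<close> is only meant
  for \<open>1 \<le> i \<le> length \<alpha>\<close>.\<close>

definition part :: "nat list \<Rightarrow> nat \<Rightarrow> nat" where
  "part \<alpha> i = \<alpha> ! (i - 1)"

definition anti_palindromic :: "nat list \<Rightarrow> bool" where
  "anti_palindromic \<alpha> \<longleftrightarrow>
     (\<forall>i. 1 \<le> i \<and> 2 * i \<le> length \<alpha> \<longrightarrow> part \<alpha> i \<noteq> part \<alpha> (length \<alpha> + 1 - i))"

definition AC :: "nat \<Rightarrow> nat list set" where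
  "AC n = {\<alpha>. is_composition n \<alpha> \<and> anti_palindromic \<alpha>}"

definition AC_plus :: "nat \<Rightarrow> nat list set" where
  "AC_plus n = {\<alpha> \<in> AC n. even (length \<alpha>) \<or>
     (odd (length \<alpha>) \<and> even (part \<alpha> ((length \<alpha> + 1) div 2)))}"

definition ac :: "nat \<Rightarrow> nat" where
  "ac n = card (AC n)"

definition ac_plus :: "nat \<Rightarrow> nat" where
  "ac_plus n = card (AC_plus n)"

fun T' :: "nat \<Rightarrow> nat" where
  "T' 0 = 0"
| "T' (Suc 0) = 1"
| "T' (Suc (Suc 0)) = 0"
| "T' (Suc (Suc (Suc n))) = T' (Suc (Suc n)) + T' (Suc n) + T' n"

text \<open>The counted sets are finite, so \<open>card\<close> is a genuine count.\<close>

lemma length_le_sum_list_pos: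
  "\<forall>a \<in> set \<alpha>. (a::nat) > 0 \<Longrightarrow> length \<alpha> \<le> sum_list \<alpha>"
  by (induction \<alpha>) auto

lemma finite_AC: "finite (AC n)"
proof (rule finite_subset)
  show "AC n \<subseteq> {\<alpha>. set \<alpha> \<subseteq> {..n} \<and> length \<alpha> \<le> n}"
    by (auto simp: AC_def is_composition_def length_le_sum_list_pos member_le_sum_list)
  show "finite {\<alpha>. set \<alpha> \<subseteq> {..n} \<and> length \<alpha> \<le> n}"
    by (rule finite_lists_length_le) simp
qed

lemma finite_AC_plus: "finite (AC_plus n)"
  using finite_AC by (simp add: AC_plus_def)

end

theory Submission
  imports Defs
begin

text \<open>
  Call the middle part of a composition of odd length its middle, and let compositions of even
  length have middle 0. Sort the anti-palindromic compositions of \<open>n\<close> by the parity \<open>r\<close> of the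
  middle, and let \<open>s n\<close> count one class. The class \<open>r = 0\<close> is the one counted by \<open>ac_plus\<close>, and
  the two classes together make up \<open>ac\<close>; so it suffices to treat both classes by one argument.

  Consider a member of the class of weight \<open>n + 2\<close>. If its first and last parts both exceed 1,
  lower each of them by one; a composition with a single part \<open>m\<close> loses 2 in this way, and \<open>[2]\<close>
  becomes empty. The first and last parts stay distinct and the middle keeps its parity, so this
  is a bijection onto the class of weight \<open>n\<close>. Otherwise exactly one outer part is 1, the
  other is at least 2 and is determined by the weight \<open>k < n\<close> of what lies between them, which
  is an arbitrary member of the class of weight \<open>k\<close>. (The one-part composition \<open>[1]\<close> has too
  small a weight to occur.) This gives (lemma \<open>card_AC_mid_add_2\<close>)
  \[ s(n+2) = s(n) + 2 \sum_{k<n} s(k), \]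
  and subtracting two consecutive instances turns it into the recurrence
  \<open>s (n + 3) = s (n + 2) + s (n + 1) + s n\<close> of \<open>T'\<close>. The values at 0, 1, 2 are 1, 0, 1 for
  even middles and 0, 1, 0 for odd ones, so the classes are counted by \<open>T' (n + 1)\<close> and \<open>T' n\<close>.
\<close>

definition middle :: "nat list \<Rightarrow> nat" where
  "middle \<alpha> = (if odd (length \<alpha>) then part \<alpha> ((length \<alpha> + 1) div 2) else 0)"

definition AC_mid :: "nat \<Rightarrow> nat \<Rightarrow> nat list set" where
  "AC_mid r n = {\<alpha> \<in> AC n. middle \<alpha> mod 2 = r}"

lemma list_outer_cases [case_names Nil single outer]:
  obtains "xs = []" | m where "xs = [m]" | a \<beta> b where "xs = a # \<beta> @ [b]"
  by (metis list.exhaust rev_exhaust)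

lemma middle_outer: "middle (a # \<beta> @ [b]) = middle \<beta>"
proof (cases "odd (length \<beta>)")
  case True
  then obtain k where "length \<beta> = 2 * k + 1" by (elim oddE)
  then show ?thesis by (simp add: middle_def part_def nth_append)
qed (simp add: middle_def)

lemma anti_palindromic_outer:
  "anti_palindromic (a # \<beta> @ [b]) \<longleftrightarrow> a \<noteq> b \<and> anti_palindromic \<beta>"
proof -
  let ?\<alpha> = "a # \<beta> @ [b]" and ?l = "length \<beta>"
  define Q where
    "Q i \<longleftrightarrow> (2 * i \<le> length ?\<alpha> \<longrightarrow> part ?\<alpha> i \<noteq> part ?\<alpha> (length ?\<alpha> + 1 - i))" for i
  have first: "Q 1 \<longleftrightarrow> a \<noteq> b"
    by (simp add: Q_def part_def nth_append)
  have inner: "Q (Suc i) \<longleftrightarrow> (2 * i \<le> ?l \<longrightarrow> part \<beta> i \<noteq> part \<beta> (?l + 1 - i))" if "1 \<le> i" for i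
  proof (cases "2 * i \<le> ?l")
    case True
    from that obtain j where "i = Suc j" by (cases i) auto
    moreover from this True have "?l - j = Suc (?l - Suc j)" by simp
    ultimately show ?thesis using True
      by (auto simp: Q_def part_def nth_append nth_Cons')
  qed (simp add: Q_def)
  have "anti_palindromic ?\<alpha> \<longleftrightarrow> (\<forall>i\<ge>1. Q i)"
    by (auto simp: anti_palindromic_def Q_def)
  also have "\<dots> \<longleftrightarrow> Q 1 \<and> (\<forall>i\<ge>1. Q (Suc i))"
    by (metis One_nat_def Suc_le_D le_SucI le_refl not_less_eq_eq not0_implies_Suc le_zero_eq)
  also have "\<dots> \<longleftrightarrow> a \<noteq> b \<and> anti_palindromic \<beta>"
    using first inner by (auto simp: anti_palindromic_def)
  finally show ?thesis .
qed

lemma Nil_in_AC_mid: "[] \<in> AC_mid r n \<longleftrightarrow> n = 0 \<and> r = 0"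
  by (auto simp: AC_mid_def AC_def is_composition_def anti_palindromic_def middle_def)

lemma single_in_AC_mid: "[m] \<in> AC_mid r n \<longleftrightarrow> m = n \<and> 0 < n \<and> n mod 2 = r"
  by (auto simp: AC_mid_def AC_def is_composition_def anti_palindromic_def middle_def part_def)

lemma outer_in_AC_mid:
  "a # \<beta> @ [b] \<in> AC_mid r n \<longleftrightarrow>
     0 < a \<and> 0 < b \<and> a \<noteq> b \<and> a + b \<le> n \<and> \<beta> \<in> AC_mid r (n - a - b)"
  by (auto simp: AC_mid_def AC_def is_composition_def anti_palindromic_outer middle_outer)

lemmas in_AC_mid = Nil_in_AC_mid single_in_AC_mid outer_in_AC_mid

lemma finite_AC_mid: "finite (AC_mid r n)"
  using finite_AC by (simp add: AC_mid_def)

text \<open>Raising the first and the last part by one each. The clauses for short lists follow the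
  same rule: a single part is both first and last, and the empty composition, having middle 0,
  is treated as a single part 0.\<close>

definition raise_ends :: "nat list \<Rightarrow> nat list" where
  "raise_ends xs = (case xs of [] \<Rightarrow> [2] | [m] \<Rightarrow> [m + 2]
     | a # _ \<Rightarrow> Suc a # butlast (tl xs) @ [Suc (last xs)])"

lemma raise_ends_simps:
  "raise_ends [] = [2]"
  "raise_ends [m] = [m + 2]"
  "raise_ends (a # \<beta> @ [b]) = Suc a # \<beta> @ [Suc b]"
  by (auto simp: raise_ends_def butlast_append split: list.split)

lemma inj_on_raise_ends: "inj_on raise_ends (AC_mid r n)"
proof (rule inj_onI)
  fix xs ys
  assume "xs \<in> AC_mid r n" "ys \<in> AC_mid r n" "raise_ends xs = raise_ends ys"
  then show "xs = ys"
    by (cases xs rule: list_outer_cases; cases ys rule: list_outer_cases)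
       (auto simp: raise_ends_simps in_AC_mid)
qed

text \<open>In the two unions \<open>k\<close> is the weight enclosed by the outer parts, so the outer part other
  than 1 must be \<open>n + 1 - k\<close>; the bound \<open>k < n\<close> expresses that this part differs from 1.\<close>

lemma AC_mid_add_2:
  "AC_mid r (n + 2) = raise_ends ` AC_mid r n
     \<union> (\<Union>k<n. (\<lambda>\<beta>. 1 # \<beta> @ [n + 1 - k]) ` AC_mid r k)
     \<union> (\<Union>k<n. (\<lambda>\<beta>. (n + 1 - k) # \<beta> @ [1]) ` AC_mid r k)"
    (is "_ = ?G \<union> ?L \<union> ?R")
proof (intro equalityI subsetI)
  fix xs assume xs: "xs \<in> AC_mid r (n + 2)"
  show "xs \<in> ?G \<union> ?L \<union> ?R"
  proof (cases xs rule: list_outer_cases)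
    case Nil
    with xs show ?thesis by (simp add: in_AC_mid)
  next
    case (single m)
    with xs have m: "m = n + 2" "n mod 2 = r" by (auto simp: in_AC_mid)
    show ?thesis
    proof (cases "n = 0")
      case True
      then have "[] \<in> AC_mid r n" using m by (simp add: in_AC_mid)
      then have "raise_ends [] \<in> ?G" by (rule imageI)
      then show ?thesis using single m True by (simp add: raise_ends_simps numeral_2_eq_2)
    next
      case False
      then have "[n] \<in> AC_mid r n" using m by (simp add: in_AC_mid)
      then have "raise_ends [n] \<in> ?G" by (rule imageI)
      then show ?thesis using single m by (simp add: raise_ends_simps)
    qed
  next
    case (outer a \<beta> b)
    with xs have *: "0 < a" "0 < b" "a \<noteq> b" "a + b \<le> n + 2" "\<beta> \<in> AC_mid r (n + 2 - a - b)"
      by (auto simp: in_AC_mid)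
    consider "a = 1" | "b = 1" | "1 < a" "1 < b" using * by linarith
    then show ?thesis
    proof cases
      case 1
      then have "n + 1 - (n + 1 - b) = b" "n + 1 - b < n" "n + 2 - a - b = n + 1 - b"
        using * by auto
      then have "xs \<in> ?L" using outer 1 *
        by (intro UN_I[of "n + 1 - b"] image_eqI[of _ _ \<beta>]) auto
      then show ?thesis by blast
    next
      case 2
      then have "n + 1 - (n + 1 - a) = a" "n + 1 - a < n" "n + 2 - a - b = n + 1 - a"
        using * by auto
      then have "xs \<in> ?R" using outer 2 *
        by (intro UN_I[of "n + 1 - a"] image_eqI[of _ _ \<beta>]) auto
      then show ?thesis by blast
    next
      case 3
      then have "n + 2 - a - b = n - (a - 1) - (b - 1)" by simp
      then have "(a - 1) # \<beta> @ [b - 1] \<in> AC_mid r n"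
        using 3 * by (auto simp: in_AC_mid)
      then have "raise_ends ((a - 1) # \<beta> @ [b - 1]) \<in> ?G" by (rule imageI)
      then show ?thesis using 3 outer by (simp add: raise_ends_simps)
    qed
  qed
next
  fix xs assume "xs \<in> ?G \<union> ?L \<union> ?R"
  then consider (G) ys where "ys \<in> AC_mid r n" "xs = raise_ends ys"
    | (L) k \<beta> where "k < n" "\<beta> \<in> AC_mid r k" "xs = 1 # \<beta> @ [n + 1 - k]"
    | (R) k \<beta> where "k < n" "\<beta> \<in> AC_mid r k" "xs = (n + 1 - k) # \<beta> @ [1]"
    by blast
  then show "xs \<in> AC_mid r (n + 2)"
  proof cases
    case G
    then show ?thesis
      by (cases ys rule: list_outer_cases) (auto simp: raise_ends_simps in_AC_mid)
  next
    case L
    then show ?thesis by (auto simp: in_AC_mid Suc_diff_le)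
  next
    case R
    then show ?thesis by (auto simp: in_AC_mid Suc_diff_le)
  qed
qed

lemma card_AC_mid_add_2:
  "card (AC_mid r (n + 2)) = card (AC_mid r n) + 2 * (\<Sum>k<n. card (AC_mid r k))"
proof -
  let ?G = "raise_ends ` AC_mid r n"
  let ?L = "\<lambda>k. (\<lambda>\<beta>. 1 # \<beta> @ [n + 1 - k]) ` AC_mid r k"
  let ?R = "\<lambda>k. (\<lambda>\<beta>. (n + 1 - k) # \<beta> @ [1]) ` AC_mid r k"
  have G: "card ?G = card (AC_mid r n)"
    by (rule card_image[OF inj_on_raise_ends])
  have L: "card (\<Union>k<n. ?L k) = (\<Sum>k<n. card (AC_mid r k))"
    by (subst card_UN_disjoint)
       (auto simp: finite_AC_mid card_image inj_on_def intro!: sum.cong)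
  have R: "card (\<Union>k<n. ?R k) = (\<Sum>k<n. card (AC_mid r k))"
    by (subst card_UN_disjoint)
       (auto simp: finite_AC_mid card_image inj_on_def intro!: sum.cong)
  have G_outer: "1 < a \<and> 1 < b"
    if "ys \<in> AC_mid r n" "raise_ends ys = a # \<beta> @ [b]" for ys a \<beta> b
    using that by (cases ys rule: list_outer_cases) (auto simp: raise_ends_simps in_AC_mid)
  have GL: "?G \<inter> (\<Union>k<n. ?L k) = {}" and GR: "?G \<inter> (\<Union>k<n. ?R k) = {}"
    by (auto dest: G_outer)
  have LR: "(\<Union>k<n. ?L k) \<inter> (\<Union>k<n. ?R k) = {}"
    by auto
  have "(?G \<union> (\<Union>k<n. ?L k)) \<inter> (\<Union>k<n. ?R k) = {}"
    using GR LR by blast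
  then show ?thesis
    unfolding AC_mid_add_2 using G L R GL
    by (simp add: card_Un_disjoint finite_AC_mid)
qed

lemma card_AC_mid_rec:
  "card (AC_mid r (n + 3)) =
     card (AC_mid r (n + 2)) + card (AC_mid r (n + 1)) + card (AC_mid r n)"
  using card_AC_mid_add_2[of r "n + 1"] card_AC_mid_add_2[of r n]
  by (simp add: eval_nat_numeral)

lemma AC_mid_0: "AC_mid r 0 = (if r = 0 then {[]} else {})"
proof -
  have "xs \<in> AC_mid r 0 \<longleftrightarrow> xs = [] \<and> r = 0" for xs
    by (cases xs rule: list_outer_cases) (auto simp: in_AC_mid)
  then show ?thesis by auto
qed

lemma AC_mid_1: "AC_mid r 1 = (if r = 1 then {[1]} else {})"
proof -
  have "xs \<in> AC_mid r 1 \<longleftrightarrow> xs = [1] \<and> r = 1" for xs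
    by (cases xs rule: list_outer_cases) (auto simp: in_AC_mid)
  then show ?thesis by auto
qed

lemma card_AC_mid_2: "card (AC_mid r 2) = card (AC_mid r 0)"
  using card_AC_mid_add_2[of r 0] by (simp add: eval_nat_numeral)

lemma card_AC_mid_even: "card (AC_mid 0 n) = T' (n + 1)"
proof (induction n rule: T'.induct)
  case (4 n)
  then show ?case using card_AC_mid_rec[of 0 n] by (simp add: eval_nat_numeral)
qed (use AC_mid_1[of 0] card_AC_mid_2[of 0] in \<open>simp_all add: AC_mid_0 eval_nat_numeral\<close>)

lemma card_AC_mid_odd: "card (AC_mid 1 n) = T' n"
proof (induction n rule: T'.induct)
  case (4 n)
  then show ?case using card_AC_mid_rec[of 1 n] by (simp add: eval_nat_numeral)
qed (use AC_mid_1[of 1] card_AC_mid_2[of 1] in \<open>simp_all add: AC_mid_0 eval_nat_numeral\<close>)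

lemma AC_plus_eq_AC_mid: "AC_plus n = AC_mid 0 n"
  by (auto simp: AC_plus_def AC_mid_def middle_def)

lemma card_AC_eq: "card (AC n) = card (AC_mid 0 n) + card (AC_mid 1 n)"
proof -
  have "AC n = AC_mid 0 n \<union> AC_mid 1 n" "AC_mid 0 n \<inter> AC_mid 1 n = {}"
    by (auto simp: AC_mid_def)
  then show ?thesis by (simp add: card_Un_disjoint finite_AC_mid)
qed

theorem mainTheorem13:
  fixes n :: nat
  shows "ac_plus n = T' (n + 1) \<and> ac n = T' (n + 1) + T' n"
  using card_AC_mid_even card_AC_mid_odd card_AC_eq
  by (simp add: ac_plus_def ac_def AC_plus_eq_AC_mid)

end
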